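(* Let $M$ be a 3-dimensional Riemannian manifold with metric tensor $g$ and $(1,1)$-tensor field $q$ whose components in local coordinates are the matrices $(g_{ij})$, $(q_i^{.j})$ given in the context. Suppose $q$ is parallel, i.e. $\nabla q=0$. Then the curvature tensor $R$ of $g$ satisfies $$R(x,y,q^2z,u)=R(x,y,z,qu)$$ for all vector fields $x,y,z,u$ on $M$.
   Context: In the local coordinates $(X^1,X^2,X^3)$ on a coordinate neighborhood $F\subset\mathbb{R}^3$ the component matrices are $$(g_{ij})=\begin{pmatrix} A & B & B \\ B & A & B \\ B & B & A \end{pmatrix},\qquad (q_i^{.j})=\begin{pmatrix} 0 & 1 & 0 \\ 0 & 0 & 1 \\ 1 & 0 & 0 \end{pmatrix},$$ where $A,B$ are smooth functions on $F$ with $A>B>0$; the lower index is the row index and $q e_i=\sum_j q_i^{.j}e_j$ for the coordinate basis $e_i=\partial/\partial X^i$. $\nabla$ is the Levi-Civita connection of $g$, $R(x,y)z=\nabla_x\nabla_yz-\nabla_y\nabla_xz-\nabla_{[x,y]}z$, and $R(x,y,z,u)=g(R(x,y)z,u)$. *)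

theory Defs
  imports "HOL-Analysis.Analysis"
begin

section \<open>Smooth maps between normed spaces\<close>

text \<open>
  \<open>Ck_on k S f\<close> is meant for open \<open>S\<close>: derivatives are two-sided derivatives at the points of \<open>S\<close>.
\<close>

fun Ck_on :: "nat \<Rightarrow> 'e::real_normed_vector set \<Rightarrow> ('e \<Rightarrow> 'b::real_normed_vector) \<Rightarrow> bool" where
  "Ck_on 0 S f \<longleftrightarrow> continuous_on S f"
| "Ck_on (Suc k) S f \<longleftrightarrow>
     (\<forall>x\<in>S. f differentiable (at x)) \<and> (\<forall>v. Ck_on k S (\<lambda>x. frechet_derivative f (at x) v))"

definition smooth_on :: "'e::real_normed_vector set \<Rightarrow> ('e \<Rightarrow> 'b::real_normed_vector) \<Rightarrow> bool" where
  "smooth_on S f \<longleftrightarrow> (\<forall>k. Ck_on k S f)"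


section \<open>Smooth manifolds\<close>

text \<open>
  A chart is a pair \<open>(U, \<phi>)\<close> of a domain and a coordinate map; only the values of \<open>\<phi>\<close> on \<open>U\<close> matter.
  The manifold is the whole type \<open>'a\<close>, its topology being the one of the type class.
\<close>

type_synonym ('a, 'n) chart = "'a set \<times> ('a \<Rightarrow> real ^ 'n)"

fun is_chart :: "('a::topological_space, 'n::finite) chart \<Rightarrow> bool" where
  "is_chart (U, \<phi>) \<longleftrightarrow> open U \<and> open (\<phi> ` U) \<and> (\<exists>\<psi>. homeomorphism U (\<phi> ` U) \<phi> \<psi>)"

fun smooth_transition :: "('a, 'n::finite) chart \<Rightarrow> ('a, 'n) chart \<Rightarrow> bool" where
  "smooth_transition (U, \<phi>) (V, \<kappa>) \<longleftrightarrow> smooth_on (\<phi> ` (U \<inter> V)) (\<kappa> \<circ> inv_into U \<phi>)"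

definition compatible :: "('a, 'n::finite) chart \<Rightarrow> ('a, 'n) chart \<Rightarrow> bool" where
  "compatible c d \<longleftrightarrow> smooth_transition c d \<and> smooth_transition d c"

text \<open>A smooth structure of dimension \<open>CARD('n)\<close>, given as a maximal atlas.\<close>

definition smooth_manifold ::
    "('a::{t2_space,second_countable_topology}, 'n::finite) chart set \<Rightarrow> bool" where
  "smooth_manifold \<A> \<longleftrightarrow>
     (\<forall>c\<in>\<A>. is_chart c) \<and>
     (\<Union>c\<in>\<A>. fst c) = UNIV \<and>
     (\<forall>c\<in>\<A>. \<forall>d\<in>\<A>. compatible c d) \<and>
     (\<forall>c. is_chart c \<and> (\<forall>d\<in>\<A>. compatible c d) \<longrightarrow> c \<in> \<A>)"

definition smooth_fun ::
    "('a::topological_space, 'n::finite) chart set \<Rightarrow> 'a set \<Rightarrow> ('a \<Rightarrow> real) \<Rightarrow> bool" where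
  "smooth_fun \<A> W f \<longleftrightarrow> (\<forall>(U, \<phi>)\<in>\<A>. smooth_on (\<phi> ` (U \<inter> W)) (f \<circ> inv_into U \<phi>))"

definition smooth_near ::
    "('a::topological_space, 'n::finite) chart set \<Rightarrow> 'a \<Rightarrow> ('a \<Rightarrow> real) set" where
  "smooth_near \<A> p = {f. \<exists>W. open W \<and> p \<in> W \<and> smooth_fun \<A> W f}"


section \<open>Tangent vectors and vector fields\<close>

text \<open>
  A tangent vector at \<open>p\<close> is a derivation at \<open>p\<close> of the algebra of germs of smooth functions. Germs are
  represented by functions that are smooth near \<open>p\<close>; on all other functions a tangent vector takes
  the value \<open>0\<close>, so that equality of tangent vectors is equality in HOL.
\<close>

type_synonym 'a tvec = "('a \<Rightarrow> real) \<Rightarrow> real"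

definition tangent_space ::
    "('a::topological_space, 'n::finite) chart set \<Rightarrow> 'a \<Rightarrow> 'a tvec set" where
  "tangent_space \<A> p = {v.
     (\<forall>f. f \<notin> smooth_near \<A> p \<longrightarrow> v f = 0) \<and>
     (\<forall>f\<in>smooth_near \<A> p. \<forall>h\<in>smooth_near \<A> p.
        (\<forall>\<^sub>F r in nhds p. f r = h r) \<longrightarrow> v f = v h) \<and>
     (\<forall>f\<in>smooth_near \<A> p. \<forall>h\<in>smooth_near \<A> p. \<forall>a b.
        v (\<lambda>r. a * f r + b * h r) = a * v f + b * v h) \<and>
     (\<forall>f\<in>smooth_near \<A> p. \<forall>h\<in>smooth_near \<A> p.
        v (\<lambda>r. f r * h r) = f p * v h + h p * v f)}"

text \<open>The coordinate vector \<open>\<partial>/\<partial>X\<^sup>i\<close> at \<open>p\<close>.\<close>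

fun coord_vec ::
    "('a::topological_space, 'n::finite) chart set \<Rightarrow> ('a, 'n) chart \<Rightarrow> 'n \<Rightarrow> 'a \<Rightarrow> 'a tvec" where
  "coord_vec \<A> (U, \<phi>) i p = (\<lambda>f.
     if f \<in> smooth_near \<A> p
     then frechet_derivative (f \<circ> inv_into U \<phi>) (at (\<phi> p)) (axis i 1) else 0)"

type_synonym 'a vfield = "'a \<Rightarrow> 'a tvec"

definition vector_fields ::
    "('a::topological_space, 'n::finite) chart set \<Rightarrow> 'a vfield set" where
  "vector_fields \<A> = {X.
     (\<forall>p. X p \<in> tangent_space \<A> p) \<and>
     (\<forall>W f. open W \<and> smooth_fun \<A> W f \<longrightarrow> smooth_fun \<A> W (\<lambda>p. X p f))}"

definition vf_add :: "'a vfield \<Rightarrow> 'a vfield \<Rightarrow> 'a vfield" where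
  "vf_add X Y = (\<lambda>p f. X p f + Y p f)"

definition vf_diff :: "'a vfield \<Rightarrow> 'a vfield \<Rightarrow> 'a vfield" where
  "vf_diff X Y = (\<lambda>p f. X p f - Y p f)"

definition vf_scale :: "('a \<Rightarrow> real) \<Rightarrow> 'a vfield \<Rightarrow> 'a vfield" where
  "vf_scale h X = (\<lambda>p f. h p * X p f)"

definition vf_zero :: "'a vfield" where
  "vf_zero = (\<lambda>p f. 0)"

definition lie_bracket ::
    "('a::topological_space, 'n::finite) chart set \<Rightarrow> 'a vfield \<Rightarrow> 'a vfield \<Rightarrow> 'a vfield" where
  "lie_bracket \<A> X Y = (\<lambda>p f.
     if f \<in> smooth_near \<A> p then X p (\<lambda>r. Y r f) - Y p (\<lambda>r. X r f) else 0)"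


section \<open>Tensor fields, Levi-Civita connection and curvature\<close>

type_synonym 'a metric = "'a \<Rightarrow> 'a tvec \<Rightarrow> 'a tvec \<Rightarrow> real"
type_synonym 'a endo = "'a \<Rightarrow> 'a tvec \<Rightarrow> 'a tvec"

definition riemannian_metric ::
    "('a::topological_space, 'n::finite) chart set \<Rightarrow> 'a metric \<Rightarrow> bool" where
  "riemannian_metric \<A> g \<longleftrightarrow>
     (\<forall>p. \<forall>v\<in>tangent_space \<A> p. \<forall>w\<in>tangent_space \<A> p. \<forall>u\<in>tangent_space \<A> p. \<forall>a b.
        g p (\<lambda>f. a * v f + b * w f) u = a * g p v u + b * g p w u) \<and>
     (\<forall>p. \<forall>v\<in>tangent_space \<A> p. \<forall>w\<in>tangent_space \<A> p. g p v w = g p w v) \<and>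
     (\<forall>p. \<forall>v\<in>tangent_space \<A> p. v \<noteq> (\<lambda>f. 0) \<longrightarrow> g p v v > 0) \<and>
     (\<forall>X\<in>vector_fields \<A>. \<forall>Y\<in>vector_fields \<A>. smooth_fun \<A> UNIV (\<lambda>p. g p (X p) (Y p)))"

definition endo_app :: "'a endo \<Rightarrow> 'a vfield \<Rightarrow> 'a vfield" where
  "endo_app q X = (\<lambda>p. q p (X p))"

text \<open>A smooth \<open>(1,1)\<close>-tensor field, as a field of endomorphisms of the tangent spaces.\<close>

definition tensor_field_1_1 ::
    "('a::topological_space, 'n::finite) chart set \<Rightarrow> 'a endo \<Rightarrow> bool" where
  "tensor_field_1_1 \<A> q \<longleftrightarrow>
     (\<forall>p. \<forall>v\<in>tangent_space \<A> p. q p v \<in> tangent_space \<A> p) \<and>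
     (\<forall>p. \<forall>v\<in>tangent_space \<A> p. \<forall>w\<in>tangent_space \<A> p. \<forall>a b.
        q p (\<lambda>f. a * v f + b * w f) = (\<lambda>f. a * q p v f + b * q p w f)) \<and>
     (\<forall>X\<in>vector_fields \<A>. endo_app q X \<in> vector_fields \<A>)"

type_synonym 'a connection = "'a vfield \<Rightarrow> 'a vfield \<Rightarrow> 'a vfield"

definition affine_connection ::
    "('a::topological_space, 'n::finite) chart set \<Rightarrow> 'a connection \<Rightarrow> bool" where
  "affine_connection \<A> nab \<longleftrightarrow>
     (\<forall>X\<in>vector_fields \<A>. \<forall>Y\<in>vector_fields \<A>. nab X Y \<in> vector_fields \<A>) \<and>
     (\<forall>X\<in>vector_fields \<A>. \<forall>Y\<in>vector_fields \<A>. \<forall>Z\<in>vector_fields \<A>.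
        nab (vf_add X Y) Z = vf_add (nab X Z) (nab Y Z) \<and>
        nab X (vf_add Y Z) = vf_add (nab X Y) (nab X Z)) \<and>
     (\<forall>X\<in>vector_fields \<A>. \<forall>Y\<in>vector_fields \<A>. \<forall>h. smooth_fun \<A> UNIV h \<longrightarrow>
        nab (vf_scale h X) Y = vf_scale h (nab X Y) \<and>
        nab X (vf_scale h Y) = vf_add (vf_scale h (nab X Y)) (vf_scale (\<lambda>p. X p h) Y))"

definition levi_civita_connection ::
    "('a::topological_space, 'n::finite) chart set \<Rightarrow> 'a metric \<Rightarrow> 'a connection \<Rightarrow> bool" where
  "levi_civita_connection \<A> g nab \<longleftrightarrow>
     affine_connection \<A> nab \<and>
     (\<forall>X\<in>vector_fields \<A>. \<forall>Y\<in>vector_fields \<A>.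
        vf_diff (nab X Y) (nab Y X) = lie_bracket \<A> X Y) \<and>
     (\<forall>X\<in>vector_fields \<A>. \<forall>Y\<in>vector_fields \<A>. \<forall>Z\<in>vector_fields \<A>. \<forall>p.
        X p (\<lambda>r. g r (Y r) (Z r)) = g p (nab X Y p) (Z p) + g p (Y p) (nab X Z p))"

text \<open>\<open>(\<nabla>\<^sub>X q) Y = \<nabla>\<^sub>X (q Y) - q (\<nabla>\<^sub>X Y)\<close>\<close>

definition cov_deriv_endo :: "'a connection \<Rightarrow> 'a endo \<Rightarrow> 'a vfield \<Rightarrow> 'a vfield \<Rightarrow> 'a vfield" where
  "cov_deriv_endo nab q X Y = vf_diff (nab X (endo_app q Y)) (endo_app q (nab X Y))"

definition parallel_endo ::
    "('a::topological_space, 'n::finite) chart set \<Rightarrow> 'a connection \<Rightarrow> 'a endo \<Rightarrow> bool" where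
  "parallel_endo \<A> nab q \<longleftrightarrow>
     (\<forall>X\<in>vector_fields \<A>. \<forall>Y\<in>vector_fields \<A>. cov_deriv_endo nab q X Y = vf_zero)"

definition curvature_op ::
    "('a::topological_space, 'n::finite) chart set \<Rightarrow> 'a connection \<Rightarrow>
     'a vfield \<Rightarrow> 'a vfield \<Rightarrow> 'a vfield \<Rightarrow> 'a vfield" where
  "curvature_op \<A> nab X Y Z =
     vf_diff (vf_diff (nab X (nab Y Z)) (nab Y (nab X Z))) (nab (lie_bracket \<A> X Y) Z)"

definition curvature_tensor ::
    "('a::topological_space, 'n::finite) chart set \<Rightarrow> 'a metric \<Rightarrow> 'a connection \<Rightarrow>
     'a vfield \<Rightarrow> 'a vfield \<Rightarrow> 'a vfield \<Rightarrow> 'a vfield \<Rightarrow> 'a \<Rightarrow> real" where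
  "curvature_tensor \<A> g nab X Y Z U = (\<lambda>p. g p (curvature_op \<A> nab X Y Z p) (U p))"


section \<open>Circulant structures\<close>

definition g_matrix :: "real \<Rightarrow> real \<Rightarrow> real ^ 3 ^ 3" where
  "g_matrix a b = vector [vector [a, b, b], vector [b, a, b], vector [b, b, a]]"

text \<open>Row index \<open>i\<close> is the lower index, that is \<open>q e\<^sub>i = (\<Sum>j. q_matrix $ i $ j * e\<^sub>j)\<close>.\<close>

definition q_matrix :: "real ^ 3 ^ 3" where
  "q_matrix = vector [vector [0, 1, 0], vector [0, 0, 1], vector [1, 0, 0]]"

text \<open>The components of \<open>g\<close> and \<open>q\<close> in the chart \<open>(U, \<phi>)\<close> are the two matrices above; \<open>F = \<phi> ` U\<close>.\<close>

fun has_circulant_components ::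
    "('a::topological_space, 3) chart set \<Rightarrow> 'a metric \<Rightarrow> 'a endo \<Rightarrow> ('a, 3) chart \<Rightarrow> bool" where
  "has_circulant_components \<A> g q (U, \<phi>) \<longleftrightarrow>
     (\<exists>A B. smooth_on (\<phi> ` U) A \<and> smooth_on (\<phi> ` U) B \<and>
        (\<forall>s\<in>\<phi> ` U. A s > B s \<and> B s > 0) \<and>
        (\<forall>p\<in>U. \<forall>i j. g p (coord_vec \<A> (U, \<phi>) i p) (coord_vec \<A> (U, \<phi>) j p)
                       = g_matrix (A (\<phi> p)) (B (\<phi> p)) $ i $ j) \<and>
        (\<forall>p\<in>U. \<forall>i. q p (coord_vec \<A> (U, \<phi>) i p)
                     = (\<lambda>f. \<Sum>j\<in>UNIV. q_matrix $ i $ j * coord_vec \<A> (U, \<phi>) j p f)))"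

end

theory Submission
  imports Defs
begin

text \<open>
  Since \<open>q\<close> is parallel, \<open>R(x,y)\<close> commutes with \<open>q\<close>. The component matrices show that \<open>q\<close> permutes
  a coordinate basis cyclically, so \<open>q\<^sup>3 = id\<close>, and that \<open>q\<close> is an isometry of \<open>g\<close>. Hence
  \<open>g(R(x,y)q\<^sup>2z, u) = g(q\<^sup>2R(x,y)z, u) = g(q\<^sup>3R(x,y)z, qu) = g(R(x,y)z, qu)\<close>.
  With tangent vectors being derivations, passing from coordinate vectors to all tangent vectors
  requires that the former span the tangent space, which rests on Hadamard's lemma.
\<close>

section \<open>Calculus of smooth maps\<close>

text \<open>At a point of the open set \<open>S\<close> the derivative depends only on nearby
  values, so \<open>f\<close> and \<open>h\<close> have equal derivatives on \<open>S\<close>. The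
  induction then passes to these derivatives.\<close>

lemma Ck_on_cong:
  assumes "open S" "\<And>x. x \<in> S \<Longrightarrow> f x = h x" "Ck_on k S f"
  shows "Ck_on k S h"
  using assms(2,3)
proof (induction k arbitrary: f h)
  case 0
  then show ?case by (metis Ck_on.simps(1) continuous_on_cong)
next
  case (Suc k)
  have d: "(h has_derivative frechet_derivative f (at x)) (at x)" if "x \<in> S" for x
  proof (rule has_derivative_transform_within_open[OF _ \<open>open S\<close> that Suc.prems(1)])
    show "(f has_derivative frechet_derivative f (at x)) (at x)"
      using Suc.prems(2) that by (simp add: frechet_derivative_works[symmetric])
  qed
  have eq: "frechet_derivative f (at x) = frechet_derivative h (at x)" if "x \<in> S" for x
    using frechet_derivative_at[OF d[OF that]] .
  have "Ck_on k S (\<lambda>x. frechet_derivative h (at x) v)" for v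
    by (rule Suc.IH[of "\<lambda>x. frechet_derivative f (at x) v"]) (use Suc.prems eq in auto)
  then show ?case using d by (auto simp: differentiable_def)
qed

text \<open>Derivatives are unique, so any explicitly known \<open>f'\<close> may replace the chosen
  \<open>frechet_derivative\<close>. The closure proofs below can thus use the usual rules for
  \<open>has_derivative\<close>.\<close>

lemma Ck_on_SucI:
  assumes "open S" and d: "\<And>x. x \<in> S \<Longrightarrow> (f has_derivative f' x) (at x)"
    and "\<And>v. Ck_on k S (\<lambda>x. f' x v)"
  shows "Ck_on (Suc k) S f"
proof -
  have "Ck_on k S (\<lambda>x. frechet_derivative f (at x) v)" for v
    by (rule Ck_on_cong[OF \<open>open S\<close> _ assms(3)[of v]]) (use frechet_derivative_at[OF d] in auto)
  then show ?thesis using d by (auto simp: differentiable_def)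
qed

lemma Ck_on_SucD:
  assumes "Ck_on (Suc k) S f"
  shows "x \<in> S \<Longrightarrow> (f has_derivative frechet_derivative f (at x)) (at x)"
    and "Ck_on k S (\<lambda>x. frechet_derivative f (at x) v)"
  using assms by (auto simp: frechet_derivative_works[symmetric])

lemma Ck_on_lower: "Ck_on (Suc k) S f \<Longrightarrow> Ck_on k S f"
proof (induction k arbitrary: f)
  case 0
  then have "\<forall>x\<in>S. f differentiable (at x)" by simp
  then show ?case
    by (simp add: continuous_at_imp_continuous_on differentiable_imp_continuous_within)
qed auto

lemma Ck_on_subset: "Ck_on k S f \<Longrightarrow> T \<subseteq> S \<Longrightarrow> Ck_on k T f"
  by (induction k arbitrary: f) (auto intro: continuous_on_subset)

lemma Ck_on_const: "open S \<Longrightarrow> Ck_on k S (\<lambda>x. c)"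
proof (induction k arbitrary: c)
  case (Suc k)
  show ?case
    by (rule Ck_on_SucI[OF Suc.prems has_derivative_const]) (rule Suc.IH[OF Suc.prems])
qed auto

lemma Ck_on_ident:
  assumes "open S"
  shows "Ck_on k S (\<lambda>x. x)"
proof (cases k)
  case (Suc m)
  show ?thesis unfolding Suc
    by (rule Ck_on_SucI[OF assms, where f' = "\<lambda>x v. v"])
       (auto intro: has_derivative_ident Ck_on_const[OF assms])
qed auto

section \<open>Closure of \<open>Ck_on\<close> under linear maps, sums and products\<close>

lemma Ck_on_bounded_linear:
  assumes "bounded_linear L" "open S"
  shows "Ck_on k S f \<Longrightarrow> Ck_on k S (\<lambda>x. L (f x))"
proof (induction k arbitrary: f)
  case 0
  then show ?case
    using assms(1) by (simp add: bounded_linear.continuous_on)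
next
  case (Suc k)
  show ?case
    by (rule Ck_on_SucI[OF assms(2) bounded_linear.has_derivative[OF assms(1) Ck_on_SucD(1)[OF Suc.prems]]])
       (auto intro!: Suc.IH Ck_on_SucD(2)[OF Suc.prems])
qed

lemma Ck_on_add:
  assumes "open S"
  shows "Ck_on k S f \<Longrightarrow> Ck_on k S h \<Longrightarrow> Ck_on k S (\<lambda>x. f x + h x)"
proof (induction k arbitrary: f h)
  case 0
  then show ?case by (simp add: continuous_on_add)
next
  case (Suc k)
  show ?case
    by (rule Ck_on_SucI[OF assms has_derivative_add
          [OF Ck_on_SucD(1)[OF Suc.prems(1)] Ck_on_SucD(1)[OF Suc.prems(2)]]])
       (auto intro!: Suc.IH Ck_on_SucD(2)[OF Suc.prems(1)] Ck_on_SucD(2)[OF Suc.prems(2)])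
qed

lemma Ck_on_sum:
  assumes "open S" "\<And>i. i \<in> I \<Longrightarrow> Ck_on k S (f i)"
  shows "Ck_on k S (\<lambda>x. \<Sum>i\<in>I. f i x)"
  using assms(2)
  by (induction I rule: infinite_finite_induct) (auto intro: Ck_on_const Ck_on_add assms(1))

text \<open>The product rule leaves \<open>f\<close> and \<open>h\<close> themselves in the
  derivative. They are known to be of order \<open>Suc k\<close>, and \<open>Ck_on_lower\<close>
  brings them down to the order \<open>k\<close> of the induction hypothesis.\<close>

lemma Ck_on_mult:
  fixes f h :: "'e::real_normed_vector \<Rightarrow> real"
  assumes "open S"
  shows "Ck_on k S f \<Longrightarrow> Ck_on k S h \<Longrightarrow> Ck_on k S (\<lambda>x. f x * h x)"
proof (induction k arbitrary: f h)
  case 0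
  then show ?case by (simp add: continuous_on_mult)
next
  case (Suc k)
  show ?case
    by (rule Ck_on_SucI[OF assms has_derivative_mult
          [OF Ck_on_SucD(1)[OF Suc.prems(1)] Ck_on_SucD(1)[OF Suc.prems(2)]]])
       (auto intro!: Ck_on_add assms Suc.IH Ck_on_SucD(2)[OF Suc.prems(1)]
          Ck_on_SucD(2)[OF Suc.prems(2)] Ck_on_lower[OF Suc.prems(1)] Ck_on_lower[OF Suc.prems(2)])
qed

section \<open>Transfer from all finite orders to smooth maps\<close>

lemma smooth_on_subset: "smooth_on S f \<Longrightarrow> T \<subseteq> S \<Longrightarrow> smooth_on T f"
  unfolding smooth_on_def by (blast intro: Ck_on_subset)

lemma smooth_on_const: "open S \<Longrightarrow> smooth_on S (\<lambda>x. c)"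
  unfolding smooth_on_def by (blast intro: Ck_on_const)

lemma smooth_on_ident: "open S \<Longrightarrow> smooth_on S (\<lambda>x. x)"
  unfolding smooth_on_def by (blast intro: Ck_on_ident)

lemma smooth_on_bounded_linear:
  "bounded_linear L \<Longrightarrow> open S \<Longrightarrow> smooth_on S f \<Longrightarrow> smooth_on S (\<lambda>x. L (f x))"
  unfolding smooth_on_def by (blast intro: Ck_on_bounded_linear)

lemma smooth_on_add:
  "open S \<Longrightarrow> smooth_on S f \<Longrightarrow> smooth_on S h \<Longrightarrow> smooth_on S (\<lambda>x. f x + h x)"
  unfolding smooth_on_def by (blast intro: Ck_on_add)

lemma smooth_on_mult:
  fixes f h :: "'e::real_normed_vector \<Rightarrow> real"
  shows "open S \<Longrightarrow> smooth_on S f \<Longrightarrow> smooth_on S h \<Longrightarrow> smooth_on S (\<lambda>x. f x * h x)"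
  unfolding smooth_on_def by (blast intro: Ck_on_mult)

lemma smooth_on_imp_has_derivative:
  assumes "smooth_on S f" "x \<in> S"
  shows "(f has_derivative frechet_derivative f (at x)) (at x)"
  using assms Ck_on_SucD(1) unfolding smooth_on_def by blast

lemma smooth_on_imp_continuous_on: "smooth_on S f \<Longrightarrow> continuous_on S f"
  unfolding smooth_on_def using Ck_on.simps(1) by blast

lemma smooth_on_frechet_derivative:
  "smooth_on S f \<Longrightarrow> smooth_on S (\<lambda>x. frechet_derivative f (at x) v)"
  unfolding smooth_on_def using Ck_on_SucD(2) by blast

text \<open>This separates the direction from the base point: only fixed directions \<open>i\<close>
  remain inside the derivative, as \<open>Ck_on\<close> requires.\<close>

lemma frechet_derivative_euclidean_expand:
  fixes f :: "'e::euclidean_space \<Rightarrow> 'b::real_normed_vector"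
  assumes "(f has_derivative frechet_derivative f (at x)) (at x)"
  shows "frechet_derivative f (at x) v = (\<Sum>i\<in>Basis. (v \<bullet> i) *\<^sub>R frechet_derivative f (at x) i)"
proof -
  interpret linear "frechet_derivative f (at x)"
    using assms by (rule has_derivative_linear)
  show ?thesis
    by (subst euclidean_representation[of v, symmetric]) (simp add: sum scaleR del: euclidean_representation)
qed

text \<open>In the chain rule the direction \<open>frechet_derivative T (at x) v\<close> varies with
  \<open>x\<close>. Expanding it in the basis gives sums of products of a smooth function with a
  partial derivative of \<open>G\<close> composed with \<open>T\<close>. The induction on the order
  therefore keeps \<open>T\<close> fixed and ranges over all smooth \<open>G\<close>.\<close>

lemma smooth_on_compose:
  fixes G :: "'e::euclidean_space \<Rightarrow> real"
  assumes T: "smooth_on S T" and G: "smooth_on R G" and im: "T ` S \<subseteq> R" and S: "open S"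
  shows "smooth_on S (\<lambda>x. G (T x))"
proof -
  have "Ck_on k S (\<lambda>x. G (T x))" if "smooth_on R G" for k and G :: "'e \<Rightarrow> real"
    using that
  proof (induction k arbitrary: G)
    case 0
    have "continuous_on S (\<lambda>x. G (T x))"
      by (rule continuous_on_compose2[OF smooth_on_imp_continuous_on[OF 0]
            smooth_on_imp_continuous_on[OF T] im])
    then show ?case by simp
  next
    case (Suc k)
    note dT = smooth_on_imp_has_derivative[OF T]
    have dG: "(G has_derivative frechet_derivative G (at (T x))) (at (T x))" if "x \<in> S" for x
      using smooth_on_imp_has_derivative[OF Suc.prems] im that by blast
    have "Ck_on k S (\<lambda>x. \<Sum>i\<in>Basis.
            (frechet_derivative T (at x) v \<bullet> i) * frechet_derivative G (at (T x)) i)" for v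
      using smooth_on_bounded_linear[OF bounded_linear_inner_left S smooth_on_frechet_derivative[OF T]]
      by (intro Ck_on_sum Ck_on_mult S Suc.IH smooth_on_frechet_derivative Suc.prems)
         (auto simp: smooth_on_def)
    then have "Ck_on k S (\<lambda>x. frechet_derivative G (at (T x)) (frechet_derivative T (at x) v))" for v
      by (rule Ck_on_cong[OF S, rotated])
         (use frechet_derivative_euclidean_expand[OF dG] in auto)
    from Ck_on_SucI[OF S has_derivative_compose[OF dT dG] this] show ?case .
  qed
  with G show ?thesis unfolding smooth_on_def by blast
qed

section \<open>Hadamard's lemma\<close>

lemma convex_segment_param:
  assumes "convex S" "a \<in> S" "x \<in> S" "t \<in> cbox 0 (1::real)"
  shows "a + t *\<^sub>R (x - a) \<in> S"
proof -
  have "a + t *\<^sub>R (x - a) = (1 - t) *\<^sub>R a + t *\<^sub>R x" by (simp add: algebra_simps)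
  then show ?thesis using assms by (simp add: convexD_alt)
qed

text \<open>Repeated differentiation under the integral sign. Convexity keeps the segment from
  \<open>a\<close> to \<open>x\<close> inside \<open>S\<close>. This gives the smoothness of the
  coefficients in Hadamard's lemma.\<close>

lemma smooth_on_radial_integral:
  fixes F :: "'e::euclidean_space \<Rightarrow> real"
  assumes F: "smooth_on S F" and S: "open S" "convex S" and a: "a \<in> S"
  shows "smooth_on S (\<lambda>x. integral (cbox 0 1) (\<lambda>t. F (a + t *\<^sub>R (x - a))))"
proof -
  note seg = convex_segment_param[OF \<open>convex S\<close> a]
  have cont: "continuous_on (S \<times> cbox 0 (1::real)) (\<lambda>(x, t). t ^ m * H (a + t *\<^sub>R (x - a)))"
    if "continuous_on S H" for H :: "'e \<Rightarrow> real" and m :: nat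
    unfolding split_beta
    by (intro continuous_intros continuous_on_compose2[OF that]) (use seg in auto)
  \<comment> \<open>Each differentiation in \<open>x\<close> produces a factor \<open>t\<close>; the weight \<open>t ^ m\<close> makes the induction work.\<close>
  have "Ck_on k S (\<lambda>x. integral (cbox 0 1) (\<lambda>t. t ^ m * F (a + t *\<^sub>R (x - a))))"
    if "smooth_on S F" for k m F
    using that
  proof (induction k arbitrary: F m)
    case 0
    show ?case
      using integral_continuous_on_param[OF cont[OF smooth_on_imp_continuous_on[OF 0]]] by simp
  next
    case (Suc k)
    \<comment> \<open>\<open>leibniz_rule\<close> takes the derivative of the integrand as a jointly
      continuous family of bounded linear maps, hence the packaging as
      \<open>blinfun\<close>.\<close>
    define D where "D y = Blinfun (frechet_derivative F (at y))" for y
    have D: "blinfun_apply (D y) = frechet_derivative F (at y)" if "y \<in> S" for y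
      using smooth_on_imp_has_derivative[OF Suc.prems that]
      unfolding D_def by (intro bounded_linear_Blinfun_apply) (rule has_derivative_bounded_linear)
    \<comment> \<open>In finite dimension continuity of an operator-valued map can be tested on
      basis vectors.\<close>
    have contD: "continuous_on S D"
    proof (rule continuous_on_blinfun_componentwise)
      fix i :: 'e
      show "continuous_on S (\<lambda>x. blinfun_apply (D x) i)"
        using smooth_on_imp_continuous_on[OF smooth_on_frechet_derivative[OF Suc.prems, of i]]
        by (rule continuous_on_eq) (simp add: D)
    qed
    define E where "E x t = t ^ Suc m *\<^sub>R D (a + t *\<^sub>R (x - a))" for x t
    have contE: "continuous_on (S \<times> cbox 0 (1::real)) (\<lambda>(x, t). E x t)"
      unfolding E_def split_beta
      by (intro continuous_intros continuous_on_compose2[OF contD]) (use seg in auto)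
    have contE': "continuous_on (cbox 0 1) (E x)" if "x \<in> S" for x
      using continuous_on_compose2[OF contE, of "cbox 0 1" "\<lambda>t. (x, t)"] that
      by (force intro: continuous_intros)
    have intF: "(\<lambda>t. t ^ m * F (a + t *\<^sub>R (x - a))) integrable_on cbox 0 1" if "x \<in> S" for x
    proof (rule integrable_continuous)
      show "continuous_on (cbox 0 1) (\<lambda>t. t ^ m * F (a + t *\<^sub>R (x - a)))"
        using continuous_on_compose2[OF cont[OF smooth_on_imp_continuous_on[OF Suc.prems]],
            of "cbox 0 1" "\<lambda>t. (x, t)"] that
        by (force intro: continuous_intros)
    qed
    have der: "((\<lambda>x. t ^ m * F (a + t *\<^sub>R (x - a))) has_derivative blinfun_apply (E x t))
                 (at x within S)" if "x \<in> S" "t \<in> cbox 0 1" for x t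
    proof -
      have "((\<lambda>x. a + t *\<^sub>R (x - a)) has_derivative (\<lambda>v. t *\<^sub>R v)) (at x within S)"
        by (auto intro!: derivative_eq_intros)
      from has_derivative_compose[OF this smooth_on_imp_has_derivative[OF Suc.prems seg[OF that]]]
      have "((\<lambda>x. t ^ m * F (a + t *\<^sub>R (x - a))) has_derivative
              (\<lambda>v. t ^ m * frechet_derivative F (at (a + t *\<^sub>R (x - a))) (t *\<^sub>R v))) (at x within S)"
        by (rule has_derivative_mult_right)
      moreover have "(\<lambda>v. t ^ m * frechet_derivative F (at (a + t *\<^sub>R (x - a))) (t *\<^sub>R v))
          = blinfun_apply (E x t)"
        unfolding E_def
        by (auto simp: D[OF seg[OF that], symmetric] blinfun.scaleR_left blinfun.scaleR_right)
      ultimately show ?thesis by simp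
    qed
    have lei: "((\<lambda>x. integral (cbox 0 1) (\<lambda>t. t ^ m * F (a + t *\<^sub>R (x - a)))) has_derivative
            blinfun_apply (integral (cbox 0 1) (E x))) (at x)" if "x \<in> S" for x
      using leibniz_rule[OF der intF contE that \<open>convex S\<close>] at_within_open[OF that \<open>open S\<close>] by simp
    have "Ck_on k S (\<lambda>x. blinfun_apply (integral (cbox 0 1) (E x)) v)" for v
    \<comment> \<open>Evaluated at \<open>v\<close>, the derivative is again a radial integral, with
      exponent \<open>Suc m\<close> and with the directional derivative of \<open>F\<close> in place
      of \<open>F\<close>.\<close>
    proof (rule Ck_on_cong[OF \<open>open S\<close> _ Suc.IH[OF smooth_on_frechet_derivative[OF Suc.prems]]])
      fix x assume x: "x \<in> S"
      show "integral (cbox 0 1) (\<lambda>t. t ^ Suc m * frechet_derivative F (at (a + t *\<^sub>R (x - a))) v)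
          = blinfun_apply (integral (cbox 0 1) (E x)) v"
        unfolding blinfun_apply_integral[OF integrable_continuous[OF contE'[OF x]]]
        by (rule integral_cong) (simp add: E_def D[OF seg[OF x]] blinfun.scaleR_left)
    qed
    from Ck_on_SucI[OF \<open>open S\<close> lei this] show ?case .
  qed
  from this[OF F, where m = 0] show ?thesis by (simp add: smooth_on_def)
qed

text \<open>Integrate the derivative of \<open>F\<close> along the segment from \<open>a\<close> to
  \<open>x\<close>. Expanding the direction \<open>x - a\<close> in the basis pulls the factors
  \<open>x \<bullet> i - a \<bullet> i\<close> out of the integral, and the remaining integrals are
  the \<open>G i\<close>.\<close>

lemma Hadamard:
  fixes F :: "'e::euclidean_space \<Rightarrow> real"
  assumes F: "smooth_on S F" and S: "open S" "convex S" and a: "a \<in> S"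
  obtains G where "\<And>i. smooth_on S (G i)"
    and "\<And>i. G i a = frechet_derivative F (at a) i"
    and "\<And>x. x \<in> S \<Longrightarrow> F x = F a + (\<Sum>i\<in>Basis. (x \<bullet> i - a \<bullet> i) * G i x)"
proof
  note seg = convex_segment_param[OF \<open>convex S\<close> a]
  let ?G = "\<lambda>i x. integral (cbox 0 1) (\<lambda>t. frechet_derivative F (at (a + t *\<^sub>R (x - a))) i)"
  show "smooth_on S (?G i)" for i
    by (rule smooth_on_radial_integral[OF smooth_on_frechet_derivative[OF F] S a])
  \<comment> \<open>At \<open>x = a\<close> the integrand is constant in \<open>t\<close>, and the
    interval has length 1.\<close>
  show "?G i a = frechet_derivative F (at a) i" for i
    by simp
  fix x assume x: "x \<in> S"
  have int: "(\<lambda>t. frechet_derivative F (at (a + t *\<^sub>R (x - a))) i) integrable_on cbox 0 1" for i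
    by (intro integrable_continuous continuous_on_compose2[OF smooth_on_imp_continuous_on
          [OF smooth_on_frechet_derivative[OF F]]] continuous_intros) (use seg[OF x] in auto)
  have "((\<lambda>t. F (a + t *\<^sub>R (x - a))) has_vector_derivative
          frechet_derivative F (at (a + t *\<^sub>R (x - a))) (x - a)) (at t within {0..1})"
    if "t \<in> {0..1}" for t
  proof -
    have "((\<lambda>t. a + t *\<^sub>R (x - a)) has_derivative (\<lambda>s. s *\<^sub>R (x - a))) (at t within {0..1})"
      by (auto intro!: derivative_eq_intros)
    moreover have dF: "(F has_derivative frechet_derivative F (at (a + t *\<^sub>R (x - a))))
        (at (a + t *\<^sub>R (x - a)))"
      using smooth_on_imp_has_derivative[OF F seg[OF x]] that by simp
    ultimately have "((\<lambda>t. F (a + t *\<^sub>R (x - a))) has_derivative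
        (\<lambda>s. frechet_derivative F (at (a + t *\<^sub>R (x - a))) (s *\<^sub>R (x - a)))) (at t within {0..1})"
      by (rule has_derivative_compose)
    then show ?thesis
      unfolding has_vector_derivative_def
      by (simp add: linear_scale[OF has_derivative_linear[OF dF]])
  qed
  from fundamental_theorem_of_calculus[OF _ this]
  have "F x - F a = integral (cbox 0 1) (\<lambda>t. frechet_derivative F (at (a + t *\<^sub>R (x - a))) (x - a))"
    by (simp add: integral_unique)
  also have "\<dots> = integral (cbox 0 1)
      (\<lambda>t. \<Sum>i\<in>Basis. ((x - a) \<bullet> i) * frechet_derivative F (at (a + t *\<^sub>R (x - a))) i)"
    by (intro integral_cong)
       (use frechet_derivative_euclidean_expand[OF smooth_on_imp_has_derivative[OF F seg[OF x]]]
        in auto)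
  also have "\<dots> = (\<Sum>i\<in>Basis. ((x - a) \<bullet> i) * ?G i x)"
    by (subst integral_sum) (auto intro!: integrable_on_mult_right int[unfolded box_real])
  finally show "F x = F a + (\<Sum>i\<in>Basis. (x \<bullet> i - a \<bullet> i) * ?G i x)"
    by (simp add: inner_diff_left)
qed

lemma sum_Basis_vec:
  "(\<Sum>b\<in>(Basis :: (real ^ 'm::finite) set). F b) = (\<Sum>i\<in>UNIV. F (axis i 1))"
proof -
  have B: "(Basis :: (real ^ 'm) set) = range (\<lambda>i. axis i 1)"
    by (auto simp: Basis_vec_def)
  have "inj (\<lambda>i :: 'm. axis i (1::real))"
    by (auto simp: inj_on_def axis_eq_axis)
  then show ?thesis
    unfolding B by (simp only: sum.reindex o_def)
qed

section \<open>Charts and smooth functions\<close>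

lemma chart_inj: "is_chart (U, \<phi>) \<Longrightarrow> inj_on \<phi> U"
  by (auto simp: homeomorphism_def inj_on_def) metis

lemma open_chart_image:
  assumes "is_chart (U, \<phi>)" "open W"
  shows "open (\<phi> ` (U \<inter> W))"
proof -
  obtain \<psi> where "homeomorphism U (\<phi> ` U) \<phi> \<psi>" "open (\<phi> ` U)"
    using assms(1) by auto
  then show ?thesis
    using homeomorphism_imp_open_map openin_open_trans openin_open_Int[OF assms(2)] by metis
qed

lemma open_chart_vimage:
  assumes "is_chart (U, \<phi>)" "open S"
  shows "open (U \<inter> \<phi> -` S)"
  using assms by (auto simp: homeomorphism_def intro: continuous_open_preimage)

context
  fixes \<A> :: "('a::{t2_space,second_countable_topology}, 'n::finite) chart set"
  assumes mfd: "smooth_manifold \<A>"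
begin

lemma atlas_is_chart: "c \<in> \<A> \<Longrightarrow> is_chart c"
  using mfd unfolding smooth_manifold_def by blast

text \<open>The openness of the chart image is handed to the first premise because the closure rules
  for \<open>smooth_on\<close> ask for it.\<close>

lemma smooth_funI:
  assumes "\<And>U \<phi>. (U, \<phi>) \<in> \<A> \<Longrightarrow> open (\<phi> ` (U \<inter> W))
    \<Longrightarrow> smooth_on (\<phi> ` (U \<inter> W)) (\<lambda>s. f (inv_into U \<phi> s))" "open W"
  shows "smooth_fun \<A> W f"
  using assms open_chart_image[OF atlas_is_chart] by (auto simp: smooth_fun_def o_def)

lemma smooth_funD:
  "smooth_fun \<A> W f \<Longrightarrow> (U, \<phi>) \<in> \<A> \<Longrightarrow> smooth_on (\<phi> ` (U \<inter> W)) (\<lambda>s. f (inv_into U \<phi> s))"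
  by (auto simp: smooth_fun_def o_def)

lemma smooth_fun_subset:
  assumes "smooth_fun \<A> W f" "open W'" "W' \<subseteq> W"
  shows "smooth_fun \<A> W' f"
  by (rule smooth_funI[OF smooth_on_subset[OF smooth_funD[OF assms(1)]]]) (use assms in auto)

lemma smooth_fun_const: "open W \<Longrightarrow> smooth_fun \<A> W (\<lambda>r. c)"
  by (rule smooth_funI[OF smooth_on_const])

lemma smooth_fun_add:
  "open W \<Longrightarrow> smooth_fun \<A> W f \<Longrightarrow> smooth_fun \<A> W h \<Longrightarrow> smooth_fun \<A> W (\<lambda>r. f r + h r)"
  by (rule smooth_funI[OF smooth_on_add]) (auto intro: smooth_funD)

lemma smooth_fun_mult:
  "open W \<Longrightarrow> smooth_fun \<A> W f \<Longrightarrow> smooth_fun \<A> W h \<Longrightarrow> smooth_fun \<A> W (\<lambda>r. f r * h r)"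
  by (rule smooth_funI[OF smooth_on_mult]) (auto intro: smooth_funD)

lemma smooth_fun_diff:
  assumes "open W" "smooth_fun \<A> W f" "smooth_fun \<A> W h"
  shows "smooth_fun \<A> W (\<lambda>r. f r - h r)"
  using smooth_fun_add[OF assms(1,2) smooth_fun_mult[OF assms(1) smooth_fun_const[OF assms(1)] assms(3)], of "-1"]
  by simp

text \<open>Read in another chart, the function is \<open>G\<close> after a transition map, which is
  smooth by compatibility of the atlas.\<close>

lemma smooth_fun_chart_compose:
  assumes c: "(U, \<phi>) \<in> \<A>" and W: "open W" "W \<subseteq> U" and G: "smooth_on (\<phi> ` W) G"
  shows "smooth_fun \<A> W (\<lambda>r. G (\<phi> r))"
proof (rule smooth_funI[OF _ W(1)])
  fix V \<kappa> assume d: "(V, \<kappa>) \<in> \<A>" and op: "open (\<kappa> ` (V \<inter> W))"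
  have "compatible (V, \<kappa>) (U, \<phi>)"
    using mfd c d unfolding smooth_manifold_def by blast
  then have T: "smooth_on (\<kappa> ` (V \<inter> W)) (\<lambda>s. \<phi> (inv_into V \<kappa> s))"
    using W(2) by (auto simp: compatible_def o_def intro: smooth_on_subset)
  have "(\<lambda>s. \<phi> (inv_into V \<kappa> s)) ` \<kappa> ` (V \<inter> W) \<subseteq> \<phi> ` W"
    using chart_inj[OF atlas_is_chart[OF d]] by auto
  then show "smooth_on (\<kappa> ` (V \<inter> W)) (\<lambda>s. G (\<phi> (inv_into V \<kappa> s)))"
    by (rule smooth_on_compose[OF T G _ op])
qed

section \<open>The algebra of functions smooth near a point\<close>

lemma smooth_nearI: "open W \<Longrightarrow> p \<in> W \<Longrightarrow> smooth_fun \<A> W f \<Longrightarrow> f \<in> smooth_near \<A> p"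
  unfolding smooth_near_def by blast

lemma smooth_near_common:
  assumes "f \<in> smooth_near \<A> p" "h \<in> smooth_near \<A> p"
  obtains W where "open W" "p \<in> W" "smooth_fun \<A> W f" "smooth_fun \<A> W h"
proof -
  obtain V W where "open V" "p \<in> V" "smooth_fun \<A> V f" "open W" "p \<in> W" "smooth_fun \<A> W h"
    using assms unfolding smooth_near_def by blast
  then show ?thesis
    using that[of "V \<inter> W"] smooth_fun_subset by blast
qed

lemma smooth_near_const: "(\<lambda>r. c) \<in> smooth_near \<A> p"
  by (rule smooth_nearI[of UNIV]) (auto intro: smooth_fun_const)

lemma smooth_near_add:
  "f \<in> smooth_near \<A> p \<Longrightarrow> h \<in> smooth_near \<A> p \<Longrightarrow> (\<lambda>r. f r + h r) \<in> smooth_near \<A> p"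
  by (erule smooth_near_common, assumption) (auto intro: smooth_nearI smooth_fun_add)

lemma smooth_near_mult:
  "f \<in> smooth_near \<A> p \<Longrightarrow> h \<in> smooth_near \<A> p \<Longrightarrow> (\<lambda>r. f r * h r) \<in> smooth_near \<A> p"
  by (erule smooth_near_common, assumption) (auto intro: smooth_nearI smooth_fun_mult)

lemma smooth_near_sum:
  "(\<And>i. i \<in> I \<Longrightarrow> f i \<in> smooth_near \<A> p) \<Longrightarrow> (\<lambda>r. \<Sum>i\<in>I. f i r) \<in> smooth_near \<A> p"
  by (induction I rule: infinite_finite_induct) (auto intro: smooth_near_const smooth_near_add)

lemma smooth_near_has_derivative:
  assumes "f \<in> smooth_near \<A> p" "(U, \<phi>) \<in> \<A>" "p \<in> U"
  shows "((\<lambda>s. f (inv_into U \<phi> s)) has_derivative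
            frechet_derivative (\<lambda>s. f (inv_into U \<phi> s)) (at (\<phi> p))) (at (\<phi> p))"
proof -
  obtain W where W: "open W" "p \<in> W" "smooth_fun \<A> W f"
    using assms(1) unfolding smooth_near_def by blast
  show ?thesis
    by (rule smooth_on_imp_has_derivative[OF smooth_funD[OF W(3) assms(2)]]) (use W assms in auto)
qed

section \<open>Tangent spaces\<close>

lemma tangent_spaceD:
  assumes "v \<in> tangent_space \<A> p"
  shows "f \<notin> smooth_near \<A> p \<Longrightarrow> v f = 0"
    and "f \<in> smooth_near \<A> p \<Longrightarrow> h \<in> smooth_near \<A> p \<Longrightarrow> \<forall>\<^sub>F r in nhds p. f r = h r \<Longrightarrow> v f = v h"
    and "f \<in> smooth_near \<A> p \<Longrightarrow> h \<in> smooth_near \<A> p \<Longrightarrow>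
           v (\<lambda>r. a * f r + b * h r) = a * v f + b * v h"
    and "f \<in> smooth_near \<A> p \<Longrightarrow> h \<in> smooth_near \<A> p \<Longrightarrow>
           v (\<lambda>r. f r * h r) = f p * v h + h p * v f"
  using assms unfolding tangent_space_def by blast+

lemma tangent_space_lincomb:
  assumes "v \<in> tangent_space \<A> p" "w \<in> tangent_space \<A> p"
  shows "(\<lambda>f. a * v f + b * w f) \<in> tangent_space \<A> p"
proof -
  note v = tangent_spaceD[OF assms(1)] and w = tangent_spaceD[OF assms(2)]
  show ?thesis
    unfolding tangent_space_def
    by (auto simp: v(1,3,4) w(1,3,4) algebra_simps) (metis v(2) w(2))
qed

lemma tangent_space_zero: "(\<lambda>f. 0) \<in> tangent_space \<A> p"
  by (simp add: tangent_space_def)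

lemma tangent_space_sum:
  assumes "\<And>i. i \<in> I \<Longrightarrow> e i \<in> tangent_space \<A> p"
  shows "(\<lambda>f. \<Sum>i\<in>I. c i * e i f) \<in> tangent_space \<A> p"
  using assms
proof (induction I rule: infinite_finite_induct)
  case (insert i I)
  then show ?case
    using tangent_space_lincomb[of "e i" p "\<lambda>f. \<Sum>i\<in>I. c i * e i f" "c i" 1] by simp
qed (auto simp: tangent_space_zero)

text \<open>The Leibniz rule for \<open>1 * 1\<close> says that \<open>v\<close> takes twice its own
  value on the constant 1, so this value is 0. Linearity gives the other constants.\<close>

lemma tangent_const:
  assumes "v \<in> tangent_space \<A> p"
  shows "v (\<lambda>r. c) = 0"
proof -
  have "v (\<lambda>r. 1) = 0"
    using tangent_spaceD(4)[OF assms smooth_near_const smooth_near_const, of 1 1] by simp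
  then show ?thesis
    using tangent_spaceD(3)[OF assms smooth_near_const smooth_near_const, of c 1 0 1] by simp
qed

lemma tangent_add:
  assumes "v \<in> tangent_space \<A> p" "f \<in> smooth_near \<A> p" "h \<in> smooth_near \<A> p"
  shows "v (\<lambda>r. f r + h r) = v f + v h"
  using tangent_spaceD(3)[OF assms, of 1 1] by simp

lemma tangent_sum:
  assumes v: "v \<in> tangent_space \<A> p" and "\<And>i. i \<in> I \<Longrightarrow> f i \<in> smooth_near \<A> p"
  shows "v (\<lambda>r. \<Sum>i\<in>I. f i r) = (\<Sum>i\<in>I. v (f i))"
  using assms(2)
proof (induction I rule: infinite_finite_induct)
  case (insert i I)
  then show ?case
    using tangent_add[OF v, of "f i" "\<lambda>r. \<Sum>i\<in>I. f i r"] by (simp add: smooth_near_sum)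
qed (simp_all add: tangent_const[OF v])

text \<open>Partial derivatives in the chart are local, linear and obey the product rule. The
  \<open>if\<close> in \<open>coord_vec\<close> supplies the value 0 on functions that are not
  smooth near \<open>p\<close>.\<close>

lemma coord_vec_in_tangent_space:
  assumes c: "(U, \<phi>) \<in> \<A>" and p: "p \<in> U"
  shows "coord_vec \<A> (U, \<phi>) i p \<in> tangent_space \<A> p"
proof -
  note d = smooth_near_has_derivative[OF _ c p]
  have inv: "inv_into U \<phi> (\<phi> p) = p"
    using chart_inj[OF atlas_is_chart[OF c]] p by simp
  have germ: "frechet_derivative (\<lambda>s. f (inv_into U \<phi> s)) (at (\<phi> p))
      = frechet_derivative (\<lambda>s. h (inv_into U \<phi> s)) (at (\<phi> p))"
    if f: "f \<in> smooth_near \<A> p" and eq: "\<forall>\<^sub>F r in nhds p. f r = h r" for f h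
  proof -
    obtain N where N: "open N" "p \<in> N" "\<And>r. r \<in> N \<Longrightarrow> f r = h r"
      using eq unfolding eventually_nhds by blast
    show ?thesis
    proof (rule frechet_derivative_transform_within_open)
      show "open (\<phi> ` (U \<inter> N))"
        by (rule open_chart_image[OF atlas_is_chart[OF c] N(1)])
      show "f (inv_into U \<phi> s) = h (inv_into U \<phi> s)" if "s \<in> \<phi> ` (U \<inter> N)" for s
        using that N(3) chart_inj[OF atlas_is_chart[OF c]] by auto
    qed (use d[OF f] p N in \<open>auto simp: differentiable_def\<close>)
  qed
  have lin: "frechet_derivative (\<lambda>s. a * f (inv_into U \<phi> s) + b * h (inv_into U \<phi> s)) (at (\<phi> p)) w
      = a * frechet_derivative (\<lambda>s. f (inv_into U \<phi> s)) (at (\<phi> p)) w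
      + b * frechet_derivative (\<lambda>s. h (inv_into U \<phi> s)) (at (\<phi> p)) w"
    if "f \<in> smooth_near \<A> p" "h \<in> smooth_near \<A> p" for f h a b w
    using fun_cong[OF frechet_derivative_at[OF has_derivative_add[OF
          has_derivative_mult_right[OF d[OF that(1)], of a]
          has_derivative_mult_right[OF d[OF that(2)], of b]]], of w]
    by simp
  have prod: "frechet_derivative (\<lambda>s. f (inv_into U \<phi> s) * h (inv_into U \<phi> s)) (at (\<phi> p)) w
      = f p * frechet_derivative (\<lambda>s. h (inv_into U \<phi> s)) (at (\<phi> p)) w
      + h p * frechet_derivative (\<lambda>s. f (inv_into U \<phi> s)) (at (\<phi> p)) w"
    if "f \<in> smooth_near \<A> p" "h \<in> smooth_near \<A> p" for f h w
    using fun_cong[OF frechet_derivative_at[OF has_derivative_mult[OF d[OF that(1)] d[OF that(2)]]], of w]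
    by (simp add: inv mult.commute)
  \<comment> \<open>Without this membership the \<open>if\<close> in \<open>coord_vec\<close> would
    not reduce for the combined function.\<close>
  have near: "(\<lambda>r. a * f r + b * h r) \<in> smooth_near \<A> p"
    if "f \<in> smooth_near \<A> p" "h \<in> smooth_near \<A> p" for f h a b
    by (intro smooth_near_add smooth_near_mult smooth_near_const that)
  show ?thesis
    unfolding tangent_space_def
    using germ by (auto simp: o_def lin prod near smooth_near_mult)
qed

text \<open>Near \<open>p\<close>, Hadamard's lemma writes \<open>f\<close> as \<open>f p\<close>
  plus a sum of products \<open>(x i - x i p) * k i\<close>. A derivation kills the constant and
  turns each product into \<open>v (x i) * k i p\<close>, and \<open>k i p\<close> is the
  \<open>i\<close>-th partial derivative of \<open>f\<close>. So the components of \<open>v\<close>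
  are its values on the coordinate functions.\<close>

lemma tangent_vector_expand:
  assumes c: "(U, \<phi>) \<in> \<A>" and p: "p \<in> U" and v: "v \<in> tangent_space \<A> p"
  shows "v = (\<lambda>f. \<Sum>i\<in>UNIV. v (\<lambda>r. \<phi> r $ i) * coord_vec \<A> (U, \<phi>) i p f)"
proof
  fix f
  show "v f = (\<Sum>i\<in>UNIV. v (\<lambda>r. \<phi> r $ i) * coord_vec \<A> (U, \<phi>) i p f)"
  proof (cases "f \<in> smooth_near \<A> p")
    \<comment> \<open>Both sides are 0 by the convention for functions that are not smooth near
      \<open>p\<close>.\<close>
    case False
    then show ?thesis by (simp add: tangent_spaceD(1)[OF v])
  next
    case True
    note ch = atlas_is_chart[OF c]
    obtain W where W: "open W" "p \<in> W" "smooth_fun \<A> W f"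
      using True unfolding smooth_near_def by blast
    \<comment> \<open>A ball is taken because Hadamard's lemma needs a convex domain.\<close>
    obtain e where e: "e > 0" "ball (\<phi> p) e \<subseteq> \<phi> ` (U \<inter> W)"
      using open_contains_ball[THEN iffD1, OF open_chart_image[OF ch W(1)], rule_format, of "\<phi> p"] p W(2)
      by auto
    let ?S = "ball (\<phi> p) e" and ?F = "\<lambda>s. f (inv_into U \<phi> s)"
    have S: "open ?S" "convex ?S" "\<phi> p \<in> ?S" using e(1) by auto
    have F: "smooth_on ?S ?F"
      by (rule smooth_on_subset[OF smooth_funD[OF W(3) c] e(2)])
    obtain G where G: "\<And>b. smooth_on ?S (G b)"
        "\<And>b. G b (\<phi> p) = frechet_derivative ?F (at (\<phi> p)) b"
        "\<And>s. s \<in> ?S \<Longrightarrow> ?F s = ?F (\<phi> p) + (\<Sum>b\<in>Basis. (s \<bullet> b - \<phi> p \<bullet> b) * G b s)"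
      using Hadamard[OF F S] by blast
    \<comment> \<open>The ball pulled back to the manifold: on this neighbourhood of
      \<open>p\<close> the expansion holds and its ingredients are smooth.\<close>
    define N where "N = U \<inter> \<phi> -` ?S"
    have N: "open N" "p \<in> N" "N \<subseteq> U" "\<phi> ` N \<subseteq> ?S"
      using open_chart_vimage[OF ch S(1)] p S(3) by (auto simp: N_def)
    define k where "k i r = G (axis i 1) (\<phi> r)" for i r
    define x where "x i r = \<phi> r $ i" for i r
    have k: "k i \<in> smooth_near \<A> p" for i
      unfolding k_def
      by (rule smooth_nearI[OF N(1,2) smooth_fun_chart_compose[OF c N(1,3) smooth_on_subset[OF G(1) N(4)]]])
    have x: "x i \<in> smooth_near \<A> p" for i
    proof -
      have "smooth_on ?S (\<lambda>s. s $ i)"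
        by (rule smooth_on_bounded_linear[OF bounded_linear_vec_nth S(1) smooth_on_ident[OF S(1)]])
      then show ?thesis
        unfolding x_def
        by (intro smooth_nearI[OF N(1,2)] smooth_fun_chart_compose[OF c N(1,3)] smooth_on_subset[OF _ N(4)])
    qed
    \<comment> \<open>Writing the difference as a sum with a constant lets
      \<open>smooth_near_add\<close> and \<open>tangent_add\<close> apply directly.\<close>
    have xs: "(\<lambda>r. x i r + - x i p) \<in> smooth_near \<A> p" for i
      by (intro smooth_near_add x smooth_near_const)
    have xsk: "(\<lambda>r. (x i r + - x i p) * k i r) \<in> smooth_near \<A> p" for i
      by (rule smooth_near_mult[OF xs k])
    have ev: "\<forall>\<^sub>F r in nhds p. f r = f p + (\<Sum>i\<in>UNIV. (x i r + - x i p) * k i r)"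
      unfolding eventually_nhds
    proof (intro exI conjI ballI)
      fix r assume r: "r \<in> N"
      show "f r = f p + (\<Sum>i\<in>UNIV. (x i r + - x i p) * k i r)"
        using G(3)[of "\<phi> r"] r N(3,4) p chart_inj[OF ch]
        by (auto simp: sum_Basis_vec inner_axis x_def k_def inv_into_f_f subset_iff)
    qed (use N in auto)
    have "v f = v (\<lambda>r. f p + (\<Sum>i\<in>UNIV. (x i r + - x i p) * k i r))"
      by (rule tangent_spaceD(2)[OF v True _ ev]) (intro smooth_near_add smooth_near_const smooth_near_sum xsk)
    also have "\<dots> = v (\<lambda>r. \<Sum>i\<in>UNIV. (x i r + - x i p) * k i r)"
      using tangent_add[OF v smooth_near_const smooth_near_sum[OF xsk]] tangent_const[OF v] by simp
    also have "\<dots> = (\<Sum>i\<in>UNIV. v (\<lambda>r. (x i r + - x i p) * k i r))"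
      by (rule tangent_sum[OF v xsk])
    also have "\<dots> = (\<Sum>i\<in>UNIV. v (x i) * k i p)"
    proof (rule sum.cong)
      fix i
      have "v (\<lambda>r. x i r + - x i p) = v (x i)"
        using tangent_add[OF v x smooth_near_const, of i "- x i p"] tangent_const[OF v] by simp
      \<comment> \<open>The other Leibniz term carries the value of \<open>x i r + - x i p\<close>
        at \<open>r = p\<close>, which is 0.\<close>
      then show "v (\<lambda>r. (x i r + - x i p) * k i r) = v (x i) * k i p"
        using tangent_spaceD(4)[OF v xs[of i] k[of i]] by simp
    qed simp
    also have "\<dots> = (\<Sum>i\<in>UNIV. v (\<lambda>r. \<phi> r $ i) * coord_vec \<A> (U, \<phi>) i p f)"
      using True by (simp add: k_def G(2) x_def[abs_def] o_def)
    finally show ?thesis .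
  qed
qed

section \<open>Metrics and endomorphism fields\<close>

lemma vf_diff_in_vector_fields:
  assumes "X \<in> vector_fields \<A>" "Y \<in> vector_fields \<A>"
  shows "vf_diff X Y \<in> vector_fields \<A>"
proof -
  have "vf_diff X Y p \<in> tangent_space \<A> p" for p
    using tangent_space_lincomb[of "X p" p "Y p" 1 "-1"] assms
    by (simp add: vector_fields_def vf_diff_def)
  then show ?thesis
    using assms by (auto simp: vector_fields_def vf_diff_def intro: smooth_fun_diff)
qed

lemma endo_app_vf_diff:
  assumes q: "tensor_field_1_1 \<A> q" and "X \<in> vector_fields \<A>" "Y \<in> vector_fields \<A>"
  shows "endo_app q (vf_diff X Y) = vf_diff (endo_app q X) (endo_app q Y)"
proof
  fix p
  have "X p \<in> tangent_space \<A> p" "Y p \<in> tangent_space \<A> p"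
    using assms unfolding vector_fields_def by auto
  \<comment> \<open>The coefficients 1 and -1 put the difference into the form of the linearity
    clause of \<open>tensor_field_1_1\<close>.\<close>
  then have "q p (\<lambda>f. 1 * X p f + -1 * Y p f) = (\<lambda>f. 1 * q p (X p) f + -1 * q p (Y p) f)"
    using q unfolding tensor_field_1_1_def by blast
  then show "endo_app q (vf_diff X Y) p = vf_diff (endo_app q X) (endo_app q Y) p"
    by (simp add: endo_app_def vf_diff_def)
qed

section \<open>Linear and bilinear expansion over finite sums\<close>

lemma endo_sum:
  assumes q: "tensor_field_1_1 \<A> q" and "\<And>i. i \<in> I \<Longrightarrow> e i \<in> tangent_space \<A> p"
  shows "q p (\<lambda>f. \<Sum>i\<in>I. c i * e i f) = (\<lambda>f. \<Sum>i\<in>I. c i * q p (e i) f)"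
proof -
  have lin: "q p (\<lambda>f. a * v f + b * w f) = (\<lambda>f. a * q p v f + b * q p w f)"
    if "v \<in> tangent_space \<A> p" "w \<in> tangent_space \<A> p" for v w a b
    using q that unfolding tensor_field_1_1_def by blast
  have zero: "q p (\<lambda>f. 0) = (\<lambda>f. 0)"
    using lin[OF tangent_space_zero tangent_space_zero, of 0 0] by simp
  show ?thesis
    using assms(2)
  proof (induction I rule: infinite_finite_induct)
    case (insert i I)
    then show ?case
      using lin[of "e i" "\<lambda>f. \<Sum>i\<in>I. c i * e i f" "c i" 1] by (simp add: tangent_space_sum)
  qed (simp_all add: zero)
qed

lemma metric_sum_left:
  assumes g: "riemannian_metric \<A> g" and "\<And>i. i \<in> I \<Longrightarrow> e i \<in> tangent_space \<A> p"
    and u: "u \<in> tangent_space \<A> p"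
  shows "g p (\<lambda>f. \<Sum>i\<in>I. c i * e i f) u = (\<Sum>i\<in>I. c i * g p (e i) u)"
proof -
  have lin: "g p (\<lambda>f. a * v f + b * w f) u = a * g p v u + b * g p w u"
    if "v \<in> tangent_space \<A> p" "w \<in> tangent_space \<A> p" for v w a b
    using g that u unfolding riemannian_metric_def by blast
  have zero: "g p (\<lambda>f. 0) u = 0"
    using lin[OF tangent_space_zero tangent_space_zero, of 0 0] by simp
  show ?thesis
    using assms(2)
  proof (induction I rule: infinite_finite_induct)
    case (insert i I)
    then show ?case
      using lin[of "e i" "\<lambda>f. \<Sum>i\<in>I. c i * e i f" "c i" 1] by (simp add: tangent_space_sum)
  qed (simp_all add: zero)
qed

text \<open>\<open>riemannian_metric\<close> states linearity in the first argument; symmetry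
  carries it over to the second.\<close>

lemma metric_sum:
  assumes g: "riemannian_metric \<A> g" and e: "\<And>i. i \<in> I \<Longrightarrow> e i \<in> tangent_space \<A> p"
    and d: "\<And>j. j \<in> J \<Longrightarrow> d j \<in> tangent_space \<A> p"
  shows "g p (\<lambda>f. \<Sum>i\<in>I. c i * e i f) (\<lambda>f. \<Sum>j\<in>J. b j * d j f)
       = (\<Sum>i\<in>I. \<Sum>j\<in>J. c i * b j * g p (e i) (d j))"
proof -
  have sym: "g p v w = g p w v" if "v \<in> tangent_space \<A> p" "w \<in> tangent_space \<A> p" for v w
    using g that unfolding riemannian_metric_def by blast
  have "g p (e i) (\<lambda>f. \<Sum>j\<in>J. b j * d j f) = (\<Sum>j\<in>J. b j * g p (e i) (d j))" if "i \<in> I" for i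
    using metric_sum_left[OF g d e[OF that], of J "\<lambda>j. j" b]
    by (simp add: sym[OF e[OF that] tangent_space_sum[OF d]] sym[OF e[OF that] d])
  then show ?thesis
    by (simp add: metric_sum_left[OF g e tangent_space_sum[OF d]] sum_distrib_left mult.assoc)
qed

text \<open>Parallelism says that each \<open>nab V\<close> commutes with \<open>q\<close>, hence so
  does every term of the curvature operator. The second conclusion makes the value of the operator
  at a point a tangent vector, to which the pointwise algebra of \<open>q\<close> and
  \<open>g\<close> applies.\<close>

lemma curvature_op_endo_commute:
  assumes q: "tensor_field_1_1 \<A> q" and lc: "levi_civita_connection \<A> g nab"
    and par: "parallel_endo \<A> nab q"
    and X: "X \<in> vector_fields \<A>" and Y: "Y \<in> vector_fields \<A>" and Z: "Z \<in> vector_fields \<A>"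
  shows "curvature_op \<A> nab X Y (endo_app q Z) = endo_app q (curvature_op \<A> nab X Y Z)"
    and "curvature_op \<A> nab X Y Z \<in> vector_fields \<A>"
proof -
  have nab: "nab V W \<in> vector_fields \<A>" if "V \<in> vector_fields \<A>" "W \<in> vector_fields \<A>" for V W
    using lc that unfolding levi_civita_connection_def affine_connection_def by blast
  have comm: "nab V (endo_app q W) = endo_app q (nab V W)"
    if "V \<in> vector_fields \<A>" "W \<in> vector_fields \<A>" for V W
  proof -
    have "cov_deriv_endo nab q V W = vf_zero"
      using par that unfolding parallel_endo_def by blast
    then show ?thesis
      by (simp add: cov_deriv_endo_def vf_diff_def vf_zero_def fun_eq_iff)
  qed
  \<comment> \<open>Since the torsion vanishes, the bracket is a difference of vector fields and so
    a vector field itself.\<close>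
  have "lie_bracket \<A> X Y = vf_diff (nab X Y) (nab Y X)"
    using lc X Y unfolding levi_civita_connection_def by simp
  then have lie: "lie_bracket \<A> X Y \<in> vector_fields \<A>"
    by (simp add: vf_diff_in_vector_fields nab X Y)
  show "curvature_op \<A> nab X Y (endo_app q Z) = endo_app q (curvature_op \<A> nab X Y Z)"
    by (simp add: curvature_op_def comm endo_app_vf_diff[OF q] vf_diff_in_vector_fields nab lie X Y Z)
  show "curvature_op \<A> nab X Y Z \<in> vector_fields \<A>"
    by (simp add: curvature_op_def vf_diff_in_vector_fields nab lie X Y Z)
qed

end

section \<open>Circulant structures\<close>

context
  fixes \<A> :: "('a::{t2_space,second_countable_topology}, 3) chart set"
    and g :: "'a metric" and q :: "'a endo" and U :: "'a set" and \<phi> :: "'a \<Rightarrow> real ^ 3" and p :: 'a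
  assumes mfd: "smooth_manifold \<A>"
    and g: "riemannian_metric \<A> g"
    and q: "tensor_field_1_1 \<A> q"
    and c: "(U, \<phi>) \<in> \<A>" and p: "p \<in> U"
    and circ: "has_circulant_components \<A> g q (U, \<phi>)"
begin

private abbreviation "e \<equiv> \<lambda>i. coord_vec \<A> (U, \<phi>) i p"

lemma circulant_endo_coord_vec: "q p (e 1) = e 2" "q p (e 2) = e 3" "q p (e 3) = e 1"
proof -
  have "q p (e i) = (\<lambda>f. \<Sum>j\<in>UNIV. q_matrix $ i $ j * e j f)" for i
    using circ p unfolding has_circulant_components.simps by blast
  then show "q p (e 1) = e 2" "q p (e 2) = e 3" "q p (e 3) = e 1"
    \<comment> \<open>Removing \<open>coord_vec.simps\<close> keeps the basis vectors folded instead
      of exposing the derivatives behind them.\<close>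
    by (simp_all add: sum_3 q_matrix_def del: coord_vec.simps)
qed

text \<open>An entry of \<open>g_matrix\<close> depends only on whether its two indices coincide,
  and the cyclic shift of indices preserves this.\<close>

lemma circulant_metric_coord_vec: "g p (q p (e i)) (q p (e j)) = g p (e i) (e j)"
proof -
  obtain a b where "g p (e i) (e j) = g_matrix a b $ i $ j" for i j
    using circ p unfolding has_circulant_components.simps by blast
  then show ?thesis
    using exhaust_3[of i] exhaust_3[of j]
    by (auto simp: circulant_endo_coord_vec g_matrix_def simp del: coord_vec.simps)
qed

section \<open>From the coordinate basis to all tangent vectors\<close>

lemma circulant_expand:
  assumes "v \<in> tangent_space \<A> p"
  obtains a where "v = (\<lambda>f. \<Sum>i\<in>UNIV. a i * e i f)"
  by (rule that[OF tangent_vector_expand[OF mfd c p assms]])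

lemma coord_in: "e i \<in> tangent_space \<A> p"
  by (rule coord_vec_in_tangent_space[OF mfd c p])

lemma circulant_endo_in: "v \<in> tangent_space \<A> p \<Longrightarrow> q p v \<in> tangent_space \<A> p"
  using q unfolding tensor_field_1_1_def by blast

text \<open>Three cyclic shifts fix every basis vector, and linearity does the rest.\<close>

lemma circulant_endo_cube:
  assumes "v \<in> tangent_space \<A> p"
  shows "q p (q p (q p v)) = v"
proof -
  obtain a where v: "v = (\<lambda>f. \<Sum>i\<in>UNIV. a i * e i f)"
    by (rule circulant_expand[OF assms])
  have "q p (q p (q p (e i))) = e i" for i
    using exhaust_3[of i] by (auto simp: circulant_endo_coord_vec simp del: coord_vec.simps)
  then show ?thesis
    by (simp add: v endo_sum[OF mfd q] coord_in circulant_endo_in del: coord_vec.simps)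
qed

lemma circulant_isometry:
  assumes "v \<in> tangent_space \<A> p" "w \<in> tangent_space \<A> p"
  shows "g p (q p v) (q p w) = g p v w"
proof -
  obtain a where v: "v = (\<lambda>f. \<Sum>i\<in>UNIV. a i * e i f)"
    by (rule circulant_expand[OF assms(1)])
  obtain b where w: "w = (\<lambda>f. \<Sum>i\<in>UNIV. b i * e i f)"
    by (rule circulant_expand[OF assms(2)])
  show ?thesis
    by (simp add: v w endo_sum[OF mfd q] metric_sum[OF mfd g] coord_in circulant_endo_in
        circulant_metric_coord_vec del: coord_vec.simps)
qed

end

theorem theorem2:
  fixes \<A> :: "('a::{t2_space,second_countable_topology}, 3) chart set"
    and g :: "'a metric" and q :: "'a endo" and nab :: "'a connection"
  assumes "smooth_manifold \<A>"
    and "riemannian_metric \<A> g"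
    and "tensor_field_1_1 \<A> q"
    and "\<forall>p. \<exists>c\<in>\<A>. p \<in> fst c \<and> has_circulant_components \<A> g q c"
    and "levi_civita_connection \<A> g nab"
    and "parallel_endo \<A> nab q"
  shows "\<forall>x\<in>vector_fields \<A>. \<forall>y\<in>vector_fields \<A>. \<forall>z\<in>vector_fields \<A>. \<forall>u\<in>vector_fields \<A>. \<forall>p.
           curvature_tensor \<A> g nab x y (endo_app q (endo_app q z)) u p
         = curvature_tensor \<A> g nab x y z (endo_app q u) p"
proof (intro ballI allI)
  fix x y z u p
  assume x: "x \<in> vector_fields \<A>" and y: "y \<in> vector_fields \<A>"
    and z: "z \<in> vector_fields \<A>" and u: "u \<in> vector_fields \<A>"
  \<comment> \<open>The chart serves only the algebra in the tangent space at \<open>p\<close>; the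
    commutation of curvature with \<open>q\<close> is global.\<close>
  obtain U \<phi> where c: "(U, \<phi>) \<in> \<A>" "p \<in> U" "has_circulant_components \<A> g q (U, \<phi>)"
    using assms(4) by (metis fst_conv surj_pair)
  note cube = circulant_endo_cube[OF assms(1-3) c] and iso = circulant_isometry[OF assms(1-3) c]
  note comm = curvature_op_endo_commute[OF assms(1,3,5,6) x y]
  have qin: "q p v \<in> tangent_space \<A> p" if "v \<in> tangent_space \<A> p" for v
    using assms(3) that unfolding tensor_field_1_1_def by blast
  define r where "r = curvature_op \<A> nab x y z p"
  have r: "r \<in> tangent_space \<A> p" and up: "u p \<in> tangent_space \<A> p"
    using comm(2)[OF z] u unfolding r_def vector_fields_def by auto
  \<comment> \<open>This allows the commutation rule to be applied a second time, with
    \<open>endo_app q z\<close> as the field.\<close>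
  have qz: "endo_app q z \<in> vector_fields \<A>"
    using assms(3) z unfolding tensor_field_1_1_def by blast
  have "curvature_tensor \<A> g nab x y (endo_app q (endo_app q z)) u p = g p (q p (q p r)) (u p)"
    unfolding curvature_tensor_def comm(1)[OF qz] comm(1)[OF z] by (simp add: endo_app_def r_def)
  \<comment> \<open>The isometry is read backwards: one more \<open>q\<close> in both arguments
    completes the cube on the left.\<close>
  also have "\<dots> = g p (q p (q p (q p r))) (q p (u p))"
    by (rule iso[symmetric]) (intro qin r up)+
  also have "\<dots> = curvature_tensor \<A> g nab x y z (endo_app q u) p"
    unfolding cube[OF r] by (simp add: curvature_tensor_def r_def endo_app_def)
  finally show "curvature_tensor \<A> g nab x y (endo_app q (endo_app q z)) u p
      = curvature_tensor \<A> g nab x y z (endo_app q u) p" .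
qed

end
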